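(* Let $S\ge 1$ be an integer, let $q\in[0,1)$, and let $f^*:[0,1]\to\mathbb{R}$ be $L_{f^*}$-Lipschitz. Run the greedy multiscale method (described in the context) from the coarsest scale $S$ down to the finest scale $1$, with $K_s$ iterations at scale $s$ of an update rule with $q$-linear iterate convergence of rate $q$. Then the returned iterate $x_1^{K_1}$ at the finest scale satisfies $$\left\lVert x^{K_1}_{1} - x^*_{1} \right\rVert_2 \;\leq\; \sqrt{2^{S-1}}\,q^{r_S}\left\lVert x_{S}^{0} -x_{S}^* \right\rVert_2 \;+\; \frac{L_{f^*}}{2}\,\frac{1}{\sqrt{2^{S+1}}}\sum_{s=1}^{S-1} 2^{s} q^{r_s},$$ where $r_s=\sum_{t=1}^{s} K_{t}$.
   Context: Scales are indexed $s=1,\dots,S$, with $s=1$ the finest. Scale $s$ uses the uniform grid on $[0,1]$ with $I_s=2^{S-s+1}+1$ points, $t_s[i]=\frac{i-1}{I_s-1}$, $i=1,\dots,I_s$ (so $I_S=3$ and $I_1=2^S+1$). At scale $s$ one solves a finite-dimensional problem $\min\{\tilde{\mathcal L}_s(x_s): x_s\in\tilde{\mathcal C}_s\subseteq\mathbb{R}^{I_s}\}$, a discretization of a continuous problem with solution $f^*$; its solution is $x_s^*\in\mathbb{R}^{I_s}$, with $x_s^*[i]=f^*(t_s[i])$. Midpoint linear interpolation: for $x\in\mathbb{R}^I$, $\underline{x}\in\mathbb{R}^{2I-1}$ is defined by $\underline{x}[i]=x[\frac{i+1}{2}]$ for odd $i$ and $\underline{x}[i]=\frac12(x[\frac i2]+x[\frac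 i2+1])$ for even $i$. $q$-linear iterate convergence: at each scale $s$ the update rule $x_s^{k+1}=U_s(x_s^k)$ satisfies $\lVert x_s^{k+1}-x_s^*\rVert_2\le q\lVert x_s^k-x_s^*\rVert_2$ for all $k\ge0$ along the iterates produced by the method. Greedy multiscale method: choose an initial $x_S^0\in\mathbb{R}^{3}$; perform $K_S$ updates at scale $S$ to get $x_S^{K_S}$. For $s=S-1,S-2,\dots,1$: set $x_s^0=\underline{x}_{s+1}^{K_{s+1}}$ (the midpoint linear interpolation of $x_{s+1}^{K_{s+1}}$) and perform $K_s$ updates (on all variables) at scale $s$ to get $x_s^{K_s}$. Return $x_1^{K_1}$. The $K_s$ are nonnegative integers. *)

theory Defs
  imports "HOL-Analysis.Analysis"
begin

text \<open>
  The dimension of the iterates changes from scale to scale, so \<open>\<real>\<^sup>n\<close> is modelled as the set of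
  extensional functions on the index set \<open>{1..n}\<close>; indices are 1-based throughout.
\<close>

definition rvec :: "nat \<Rightarrow> (nat \<Rightarrow> real) set" where
  "rvec n = ({1..n} \<rightarrow>\<^sub>E UNIV)"

definition dist2 :: "nat \<Rightarrow> (nat \<Rightarrow> real) \<Rightarrow> (nat \<Rightarrow> real) \<Rightarrow> real" where
  "dist2 n x y = L2_set (\<lambda>i. x i - y i) {1..n}"

text \<open>Scale \<open>1\<close> is the finest and scale \<open>S\<close> the coarsest; only \<open>1 \<le> s \<le> S\<close> is meaningful below.\<close>

definition grid_size :: "nat \<Rightarrow> nat \<Rightarrow> nat" where
  "grid_size S s = 2 ^ (S - s + 1) + 1"

definition grid_point :: "nat \<Rightarrow> nat \<Rightarrow> nat \<Rightarrow> real" where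
  "grid_point S s i = (real i - 1) / (real (grid_size S s) - 1)"

definition midpoint_interp :: "nat \<Rightarrow> (nat \<Rightarrow> real) \<Rightarrow> (nat \<Rightarrow> real)" where
  "midpoint_interp n x = (\<lambda>i\<in>{1..2 * n - 1}.
     if odd i then x ((i + 1) div 2) else (x (i div 2) + x (i div 2 + 1)) / 2)"

text \<open>
  \<open>greedy_init S K U x0 s\<close> is the starting point \<open>x\<^sub>s\<^sup>0\<close> at scale \<open>s\<close> of the greedy multiscale method with
  update rules \<open>U s\<close>, iteration counts \<open>K s\<close> and initial point \<open>x0\<close> at scale \<open>S\<close>;
  \<open>greedy_iter S K U x0 s k\<close> is the iterate \<open>x\<^sub>s\<^sup>k\<close>.
\<close>

function greedy_init ::
  "nat \<Rightarrow> (nat \<Rightarrow> nat) \<Rightarrow> (nat \<Rightarrow> (nat \<Rightarrow> real) \<Rightarrow> (nat \<Rightarrow> real)) \<Rightarrow> (nat \<Rightarrow> real) \<Rightarrow> nat \<Rightarrow> (nat \<Rightarrow> real)"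
where
  "greedy_init S K U x0 s =
     (if s \<ge> S then x0
      else midpoint_interp (grid_size S (s + 1))
             ((U (s + 1) ^^ K (s + 1)) (greedy_init S K U x0 (s + 1))))"
  by pat_completeness auto
termination by (relation "Wellfounded.measure (\<lambda>(S, K, U, x0, s). S - s)") auto

declare greedy_init.simps [simp del]

definition greedy_iter ::
  "nat \<Rightarrow> (nat \<Rightarrow> nat) \<Rightarrow> (nat \<Rightarrow> (nat \<Rightarrow> real) \<Rightarrow> (nat \<Rightarrow> real)) \<Rightarrow> (nat \<Rightarrow> real) \<Rightarrow> nat \<Rightarrow> nat \<Rightarrow> (nat \<Rightarrow> real)"
where
  "greedy_iter S K U x0 s k = (U s ^^ k) (greedy_init S K U x0 s)"

text \<open>
  The iterates the method produces at scale \<open>s\<close> are \<open>x\<^sub>s\<^sup>0, \<dots>, x\<^sub>s\<^sup>k\<close> with \<open>k = K s\<close>, so contraction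
  is required for the \<open>K s\<close> updates that are actually performed.
\<close>

definition q_linear_convergence ::
  "nat \<Rightarrow> (nat \<Rightarrow> nat) \<Rightarrow> (nat \<Rightarrow> (nat \<Rightarrow> real) \<Rightarrow> (nat \<Rightarrow> real)) \<Rightarrow> (nat \<Rightarrow> real) \<Rightarrow>
   (nat \<Rightarrow> (nat \<Rightarrow> real)) \<Rightarrow> real \<Rightarrow> bool"
where
  "q_linear_convergence S K U x0 xs q \<longleftrightarrow>
     (\<forall>s\<in>{1..S}. \<forall>k<K s.
        dist2 (grid_size S s) (greedy_iter S K U x0 s (Suc k)) (xs s)
          \<le> q * dist2 (grid_size S s) (greedy_iter S K U x0 s k) (xs s))"

end

theory Submission imports Defs begin

text \<open>
  Midpoint interpolation doubles squared distances at most, because the new entries are averages of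
  two old ones and \<open>((a + b) / 2)\<^sup>2 \<le> (a\<^sup>2 + b\<^sup>2) / 2\<close>. Interpolating the coarse solution misses the
  next finer one only at the \<open>2 ^ (S - s)\<close> new points, each time by at most \<open>L / 2 ^ (S - s + 1)\<close>.
  The initial errors at consecutive scales thus satisfy
  \<open>e\<^sub>s \<le> sqrt 2 * q ^ K (s + 1) * e\<^sub>s\<^sub>+\<^sub>1 + L / (2 * sqrt (2 ^ (S - s)))\<close>, which unrolls to the claimed bound.
\<close>

lemma dist2_triangle: "dist2 n x z \<le> dist2 n x y + dist2 n y z"
  using L2_set_triangle_ineq[of "\<lambda>i. x i - y i" "\<lambda>i. y i - z i" "{1..n}"]
  by (simp add: dist2_def)

lemma dist2_nonneg: "0 \<le> dist2 n x y"
  by (simp add: dist2_def)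

lemma sum_odd_even_split:
  fixes g :: "nat \<Rightarrow> 'a::comm_monoid_add"
  shows "(\<Sum>i=1..2 * m + 1. g i) = (\<Sum>j=1..Suc m. g (2 * j - 1)) + (\<Sum>j=1..m. g (2 * j))"
  by (induction m) (simp_all add: ac_simps)

lemma midpoint_interp_odd:
  "j \<in> {1..Suc m} \<Longrightarrow> midpoint_interp (Suc m) x (2 * j - 1) = x j"
  by (auto simp: midpoint_interp_def)

lemma midpoint_interp_even:
  "j \<in> {1..m} \<Longrightarrow> midpoint_interp (Suc m) x (2 * j) = (x j + x (Suc j)) / 2"
  by (auto simp: midpoint_interp_def)

text \<open>Odd positions hold copies of the old entries and even positions hold averages, so the
  sum of squares splits by parity. Both error estimates below start from this form; the length is
  written \<open>Suc m\<close> so that the interpolant has length \<open>2 * m + 1\<close> without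
  subtraction.\<close>

lemma dist2_midpoint_interp_square:
  "(dist2 (2 * m + 1) (midpoint_interp (Suc m) x) y)\<^sup>2 =
     (\<Sum>j=1..Suc m. (x j - y (2 * j - 1))\<^sup>2) + (\<Sum>j=1..m. ((x j + x (Suc j)) / 2 - y (2 * j))\<^sup>2)"
proof -
  let ?g = "\<lambda>i. (midpoint_interp (Suc m) x i - y i)\<^sup>2"
  have "(dist2 (2 * m + 1) (midpoint_interp (Suc m) x) y)\<^sup>2 = (\<Sum>i=1..2 * m + 1. ?g i)"
    unfolding dist2_def L2_set_def by (rule real_sqrt_pow2) (intro sum_nonneg zero_le_power2)
  also have "\<dots> = (\<Sum>j=1..Suc m. ?g (2 * j - 1)) + (\<Sum>j=1..m. ?g (2 * j))"
    by (rule sum_odd_even_split)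
  also have "(\<Sum>j=1..Suc m. ?g (2 * j - 1)) = (\<Sum>j=1..Suc m. (x j - y (2 * j - 1))\<^sup>2)"
    by (intro sum.cong refl) (simp only: midpoint_interp_odd)
  also have "(\<Sum>j=1..m. ?g (2 * j)) = (\<Sum>j=1..m. ((x j + x (Suc j)) / 2 - y (2 * j))\<^sup>2)"
    by (intro sum.cong refl) (simp only: midpoint_interp_even)
  finally show ?thesis .
qed

text \<open>Counting weights: the squared difference \<open>z j\<close> of an old entry appears once
  for its copy, and with weight 1/2 in each of the at most two averages that use it. Its total
  weight is therefore at most 2.\<close>

lemma dist2_midpoint_interp_le:
  "dist2 (2 * m + 1) (midpoint_interp (Suc m) x) (midpoint_interp (Suc m) y)
     \<le> sqrt 2 * dist2 (Suc m) x y"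
proof (rule power2_le_imp_le)
  define z where "z j = (x j - y j)\<^sup>2" for j
  have "(dist2 (2 * m + 1) (midpoint_interp (Suc m) x) (midpoint_interp (Suc m) y))\<^sup>2
      = (\<Sum>j=1..Suc m. z j) + (\<Sum>j=1..m. ((x j + x (Suc j)) / 2 - (y j + y (Suc j)) / 2)\<^sup>2)"
    unfolding dist2_midpoint_interp_square z_def
    by (intro arg_cong2[where f = "(+)"] sum.cong refl)
      (simp_all only: midpoint_interp_odd midpoint_interp_even)
  also have "\<dots> \<le> (\<Sum>j=1..Suc m. z j) + (\<Sum>j=1..m. (z j + z (Suc j)) / 2)"
  proof (intro add_left_mono sum_mono)
    fix j
    \<comment> \<open>For differences a and b, (a^2 + b^2)/2 - ((a + b)/2)^2 = ((a -
      b)/2)^2.\<close>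
    have "0 \<le> ((x j - y j) - (x (Suc j) - y (Suc j)))\<^sup>2" by simp
    then show "((x j + x (Suc j)) / 2 - (y j + y (Suc j)) / 2)\<^sup>2 \<le> (z j + z (Suc j)) / 2"
      by (simp add: z_def power2_eq_square field_simps)
  qed
  also have "(\<Sum>j=1..m. (z j + z (Suc j)) / 2) = ((\<Sum>j=1..m. z j) + (\<Sum>j=1..m. z (Suc j))) / 2"
    by (simp add: sum.distrib flip: sum_divide_distrib)
  also have "\<dots> \<le> (\<Sum>j=1..Suc m. z j)"
  proof -
    have mean: "(a + b) / 2 \<le> c" if "a \<le> c" "b \<le> c" for a b c :: real
      using that by simp
    \<comment> \<open>The plain sum omits only the last term of the full one, and the shifted sum
      only the first.\<close>
    have "(\<Sum>j=1..m. z j) \<le> (\<Sum>j=1..Suc m. z j)" by (simp add: z_def)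
    moreover have "(\<Sum>j=1..m. z (Suc j)) \<le> (\<Sum>j=1..Suc m. z j)"
      unfolding sum.shift_bounds_cl_Suc_ivl[symmetric] by (rule sum_mono2) (auto simp: z_def)
    ultimately show ?thesis
      by (rule mean)
  qed
  also have "(\<Sum>j=1..Suc m. z j) + (\<Sum>j=1..Suc m. z j) = (sqrt 2 * dist2 (Suc m) x y)\<^sup>2"
    unfolding dist2_def L2_set_def z_def power_mult_distrib
    by (subst real_sqrt_pow2) (simp_all add: sum_nonneg)
  finally show "(dist2 (2 * m + 1) (midpoint_interp (Suc m) x) (midpoint_interp (Suc m) y))\<^sup>2
      \<le> (sqrt 2 * dist2 (Suc m) x y)\<^sup>2"
    by simp
qed (simp add: dist2_nonneg)

lemma dist2_midpoint_interp_refinement_le: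
  assumes "c \<ge> 0"
    and odd: "\<And>j. j \<in> {1..Suc m} \<Longrightarrow> y (2 * j - 1) = x j"
    and even: "\<And>j. j \<in> {1..m} \<Longrightarrow> \<bar>(x j + x (Suc j)) / 2 - y (2 * j)\<bar> \<le> c"
  shows "dist2 (2 * m + 1) (midpoint_interp (Suc m) x) y \<le> sqrt (real m) * c"
proof (rule power2_le_imp_le)
  have "(\<Sum>j=1..m. ((x j + x (Suc j)) / 2 - y (2 * j))\<^sup>2) \<le> (\<Sum>j=1..m. c\<^sup>2)"
    using even by (intro sum_mono) (metis abs_ge_zero power2_abs power_mono)
  moreover have "(\<Sum>j=1..Suc m. (x j - y (2 * j - 1))\<^sup>2) = 0"
    by (intro sum.neutral ballI) (simp only: odd, simp)
  ultimately show "(dist2 (2 * m + 1) (midpoint_interp (Suc m) x) y)\<^sup>2 \<le> (sqrt (real m) * c)\<^sup>2"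
    unfolding dist2_midpoint_interp_square by (simp add: power_mult_distrib)
qed (use assms(1) in simp)

text \<open>With \<open>m = 2 ^ (S - s)\<close>, this equation and the next put the sizes of
  neighbouring grids into the shapes \<open>2 * m + 1\<close> and \<open>Suc m\<close> of the
  interpolation lemmas.\<close>

lemma grid_size_pred: "s < S \<Longrightarrow> grid_size S s = 2 * 2 ^ (S - s) + 1"
  by (simp add: grid_size_def)

lemma grid_size_Suc: "s < S \<Longrightarrow> grid_size S (Suc s) = Suc (2 ^ (S - s))"
  by (simp add: grid_size_def Suc_diff_Suc)

lemma grid_point_eq: "grid_point S s i = (real i - 1) / 2 ^ (S - s + 1)"
  by (simp add: grid_point_def grid_size_def)

lemma grid_point_in_unit: "i \<in> {1..grid_size S s} \<Longrightarrow> grid_point S s i \<in> {0..1}"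
  by (auto simp: grid_point_def divide_le_eq_1)

text \<open>A new grid point lies midway between two coarse ones, at distance 1/(2m) from each,
  where m is the number of new points. Both neighbouring values, hence their average, are within
  L/(2m) of the value there, and sqrt m * L/(2m) = (L/2)/sqrt m.\<close>

lemma dist2_midpoint_interp_lipschitz_samples_le:
  assumes lip: "L-lipschitz_on {0..1} f" and "s < S"
    and coarse: "\<And>i. i \<in> {1..grid_size S (Suc s)} \<Longrightarrow> x i = f (grid_point S (Suc s) i)"
    and fine: "\<And>i. i \<in> {1..grid_size S s} \<Longrightarrow> y i = f (grid_point S s i)"
  shows "dist2 (grid_size S s) (midpoint_interp (grid_size S (Suc s)) x) y
    \<le> L / 2 * (1 / sqrt (2 ^ (S - s)))"
proof -
  define m :: nat where "m = 2 ^ (S - s)"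
  have N: "grid_size S s = 2 * m + 1" "grid_size S (Suc s) = Suc m"
    using grid_size_pred[OF \<open>s < S\<close>] grid_size_Suc[OF \<open>s < S\<close>] by (simp_all add: m_def)
  have t: "grid_point S s i = (real i - 1) / (2 * real m)"
    "grid_point S (Suc s) i = (real i - 1) / real m" for i
    using \<open>s < S\<close> by (simp_all add: grid_point_eq m_def Suc_diff_Suc)
  have "real m > 0" by (simp add: m_def)
  have "L \<ge> 0" by (rule lipschitz_on_nonneg[OF lip])
  have close: "\<bar>x k - y (2 * j)\<bar> \<le> L / (2 * real m)" if "j \<in> {1..m}" "k = j \<or> k = Suc j" for j k
  proof -
    have k: "k \<in> {1..grid_size S (Suc s)}" and j: "2 * j \<in> {1..grid_size S s}"
      using that by (auto simp: N)
    have "\<bar>x k - y (2 * j)\<bar> \<le> L * \<bar>grid_point S (Suc s) k - grid_point S s (2 * j)\<bar>"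
      using lipschitz_onD[OF lip grid_point_in_unit[OF k] grid_point_in_unit[OF j]]
      by (simp add: coarse[OF k] fine[OF j] dist_real_def)
    \<comment> \<open>Coarse point \<open>j\<close> is the left neighbour of the midpoint and
      \<open>Suc j\<close> the right one.\<close>
    also have "grid_point S (Suc s) k - grid_point S s (2 * j)
        = (if k = j then - 1 else 1) / (2 * real m)"
      using that(2) \<open>real m > 0\<close> by (auto simp: t field_simps)
    finally show ?thesis by (simp add: abs_div split: if_splits)
  qed
  have "dist2 (2 * m + 1) (midpoint_interp (Suc m) x) y \<le> sqrt (real m) * (L / (2 * real m))"
  proof (rule dist2_midpoint_interp_refinement_le)
    fix j assume j: "j \<in> {1..Suc m}"
    \<comment> \<open>The grids are nested, so both solutions sample \<open>f\<close> at the same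
      place here.\<close>
    have "grid_point S s (2 * j - 1) = grid_point S (Suc s) j"
      using j \<open>real m > 0\<close> by (simp add: t of_nat_diff field_simps)
    then show "y (2 * j - 1) = x j"
      using j coarse[of j] fine[of "2 * j - 1"] by (simp only: N) force
  next
    fix j assume "j \<in> {1..m}"
    then show "\<bar>(x j + x (Suc j)) / 2 - y (2 * j)\<bar> \<le> L / (2 * real m)"
      using close[of j j] close[of j "Suc j"] by (simp add: abs_le_iff field_simps)
  qed (use \<open>L \<ge> 0\<close> in simp)
  also have "\<dots> = L / 2 * (1 / sqrt (real m))"
    using \<open>real m > 0\<close> by (simp add: field_simps)
  finally show ?thesis
    by (simp add: N m_def)
qed

text \<open>Contraction is available only for the updates actually performed, so the induction stops
  at \<open>K s\<close>.\<close>

lemma greedy_iter_dist2_le: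
  assumes "q_linear_convergence S K U x0 xs q" "0 \<le> q" "s \<in> {1..S}" "k \<le> K s"
  shows "dist2 (grid_size S s) (greedy_iter S K U x0 s k) (xs s)
    \<le> q ^ k * dist2 (grid_size S s) (greedy_init S K U x0 s) (xs s)"
  using assms(4)
proof (induction k)
  case 0
  then show ?case by (simp add: greedy_iter_def)
next
  case (Suc k)
  have "dist2 (grid_size S s) (greedy_iter S K U x0 s (Suc k)) (xs s)
      \<le> q * dist2 (grid_size S s) (greedy_iter S K U x0 s k) (xs s)"
    using assms Suc.prems by (auto simp: q_linear_convergence_def)
  also have "\<dots> \<le> q * (q ^ k * dist2 (grid_size S s) (greedy_init S K U x0 s) (xs s))"
    using Suc assms(2) by (intro mult_left_mono) auto
  finally show ?case by (simp add: mult.assoc)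
qed

theorem theorem3p5:
  fixes S :: nat
    and q L :: real
    and f :: "real \<Rightarrow> real"
    and K :: "nat \<Rightarrow> nat"
    and loss :: "nat \<Rightarrow> (nat \<Rightarrow> real) \<Rightarrow> real"
    and C :: "nat \<Rightarrow> (nat \<Rightarrow> real) set"
    and xs :: "nat \<Rightarrow> (nat \<Rightarrow> real)"
    and U :: "nat \<Rightarrow> (nat \<Rightarrow> real) \<Rightarrow> (nat \<Rightarrow> real)"
    and x0 :: "nat \<Rightarrow> real"
  assumes "S \<ge> 1"
    and "0 \<le> q" and "q < 1"
    and "L-lipschitz_on {0..1} f"
    and "\<And>s. s \<in> {1..S} \<Longrightarrow> C s \<subseteq> rvec (grid_size S s)"
    and "\<And>s. s \<in> {1..S} \<Longrightarrow> is_arg_min (loss s) (\<lambda>x. x \<in> C s) (xs s)"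
    and "\<And>s i. s \<in> {1..S} \<Longrightarrow> i \<in> {1..grid_size S s} \<Longrightarrow> xs s i = f (grid_point S s i)"
    and "\<And>s. s \<in> {1..S} \<Longrightarrow> U s \<in> rvec (grid_size S s) \<rightarrow> rvec (grid_size S s)"
    and "x0 \<in> rvec (grid_size S S)"
    and "q_linear_convergence S K U x0 xs q"
  shows "dist2 (grid_size S 1) (greedy_iter S K U x0 1 (K 1)) (xs 1)
    \<le> sqrt (2 ^ (S - 1)) * q ^ (\<Sum>t=1..S. K t) * dist2 (grid_size S S) x0 (xs S)
      + L / 2 * (1 / sqrt (2 ^ (S + 1))) * (\<Sum>s=1..S - 1. 2 ^ s * q ^ (\<Sum>t=1..s. K t))"
proof -
  define D where "D s = dist2 (grid_size S s) (greedy_init S K U x0 s) (xs s)" for s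
  define E where "E s = dist2 (grid_size S s) (greedy_iter S K U x0 s (K s)) (xs s)" for s
  define r where "r s = (\<Sum>t=1..s. K t)" for s
  have ED: "E s \<le> q ^ K s * D s" if "s \<in> {1..S}" for s
    unfolding E_def D_def using greedy_iter_dist2_le[OF assms(10,2) that order_refl] .
  have initial_error: "D s \<le> sqrt 2 * E (Suc s) + L / 2 * (1 / sqrt (2 ^ (S - s)))" if "s \<in> {1..<S}" for s
  proof -
    have "s < S" using that by simp
    let ?N = "grid_size S (Suc s)"
    let ?x = "greedy_iter S K U x0 (Suc s) (K (Suc s))"
    have init: "greedy_init S K U x0 s = midpoint_interp ?N ?x"
      using \<open>s < S\<close> by (subst greedy_init.simps) (simp add: greedy_iter_def)
    \<comment> \<open>The interpolated coarse solution is the intermediate point: it separates the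
      inherited iteration error from the discretization error.\<close>
    have "D s \<le> dist2 (grid_size S s) (midpoint_interp ?N ?x) (midpoint_interp ?N (xs (Suc s)))
        + dist2 (grid_size S s) (midpoint_interp ?N (xs (Suc s))) (xs s)"
      unfolding D_def init by (rule dist2_triangle)
    also have "dist2 (grid_size S s) (midpoint_interp ?N ?x) (midpoint_interp ?N (xs (Suc s)))
        \<le> sqrt 2 * E (Suc s)"
      unfolding E_def grid_size_pred[OF \<open>s < S\<close>] grid_size_Suc[OF \<open>s < S\<close>]
      by (rule dist2_midpoint_interp_le)
    also have "dist2 (grid_size S s) (midpoint_interp ?N (xs (Suc s))) (xs s)
        \<le> L / 2 * (1 / sqrt (2 ^ (S - s)))"
      using that
      by (intro dist2_midpoint_interp_lipschitz_samples_le[OF assms(4) \<open>s < S\<close>] assms(7)) auto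
    finally show ?thesis by simp
  qed
  \<comment> \<open>The induction runs from fine to coarse, against the order of the method: the
    final error is fixed and its bound is traced back to the initial error at scale
    \<open>m\<close>, until \<open>m = S\<close>.\<close>
  have unrolled: "E 1 \<le> sqrt (2 ^ (m - 1)) * q ^ r m * D m
      + L / 2 * (1 / sqrt (2 ^ (S + 1))) * (\<Sum>s=1..m - 1. 2 ^ s * q ^ r s)"
    if "1 \<le> m" "m \<le> S" for m
    using that
  proof (induction m rule: dec_induct)
    case base
    show ?case using ED[of 1] assms(1) by (simp add: r_def)
  next
    case (step m)
    let ?c = "sqrt (2 ^ (m - 1)) * q ^ r m"
    have m: "m \<in> {1..<S}" using step.hyps step.prems by simp
    have "D m \<le> sqrt 2 * (q ^ K (Suc m) * D (Suc m)) + L / 2 * (1 / sqrt (2 ^ (S - m)))"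
      using m by (intro order.trans[OF initial_error[OF m]] add_right_mono mult_left_mono ED) auto
    then have "?c * D m
        \<le> ?c * (sqrt 2 * (q ^ K (Suc m) * D (Suc m)) + L / 2 * (1 / sqrt (2 ^ (S - m))))"
      using \<open>0 \<le> q\<close> by (intro mult_left_mono) auto
    also have "\<dots> = sqrt (2 ^ m) * q ^ r (Suc m) * D (Suc m)
        + L / 2 * (sqrt (2 ^ (m - 1)) / sqrt (2 ^ (S - m))) * q ^ r m"
    proof -
      have "sqrt (2 ^ m) = sqrt (2 ^ (m - 1)) * sqrt 2"
        using m by (cases m) (simp_all add: real_sqrt_mult)
      moreover have "r (Suc m) = r m + K (Suc m)"
        by (simp add: r_def)
      ultimately show ?thesis
        by (simp add: algebra_simps power_add)
    qed
    \<comment> \<open>The exponents satisfy (m - 1)/2 - (S - m)/2 = m - (S + 1)/2, so the dependence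
      on \<open>S\<close> is a common factor of all summands.\<close>
    also have "sqrt (2 ^ (m - 1)) / sqrt (2 ^ (S - m)) = 1 / sqrt (2 ^ (S + 1)) * 2 ^ m"
    proof -
      have "sqrt (2 ^ (m - 1)) * sqrt (2 ^ (S + 1)) = sqrt (2 ^ (m - 1 + (S + 1)))"
        by (simp add: power_add real_sqrt_mult)
      also have "m - 1 + (S + 1) = 2 * m + (S - m)"
        using m by simp
      also have "sqrt (2 ^ (2 * m + (S - m))) = 2 ^ m * sqrt (2 ^ (S - m))"
        by (simp add: power_add real_sqrt_mult power_mult mult.commute[of 2 m])
      finally show ?thesis by (simp add: field_simps)
    qed
    finally have "?c * D m \<le> sqrt (2 ^ m) * q ^ r (Suc m) * D (Suc m)
        + L / 2 * (1 / sqrt (2 ^ (S + 1))) * (2 ^ m * q ^ r m)"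
      by (simp only: mult.assoc)
    moreover have "(\<Sum>s=1..Suc m - 1. 2 ^ s * q ^ r s)
        = (\<Sum>s=1..m - 1. 2 ^ s * q ^ r s) + 2 ^ m * q ^ r m"
      using m by (cases m) simp_all
    ultimately show ?case
      using step.IH m by (simp only: distrib_left diff_Suc_1) simp
  qed
  have "greedy_init S K U x0 S = x0"
    by (subst greedy_init.simps) simp
  then show ?thesis
    using unrolled[OF assms(1) order_refl] by (simp only: D_def E_def r_def)
qed

end
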